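(* Let $\Gamma=\mathrm{SC}(G,R,L,S)$ be a semi-Cayley graph over a finite abelian group $G$ of order $n$, and let $\alpha,\beta$ be nonzero complex numbers. Let $X=\{z\in G:\chi_z(S)=0\}$. Then $(\alpha,\beta)$-revival occurs on $\Gamma$ from a vertex $u=(g,1)$ to a vertex $v=(h,1)$ at time $t$ if and only if the following hold: (a) $a=g^{-1}h$ has order two (and hence $n$ is even); (b) with $G_0=\{z\in G:\chi_a(z)=1\}$ and $G_1=\{z\in G:\chi_a(z)=-1\}$: for every $z\in G_0$, $\exp(\imath t\lambda_z^-)=\alpha+\beta$; for every $z\in G_1$, $\exp(\imath t\lambda_z^-)=\alpha-\beta$; for every $z\in G_0\setminus X$, $\exp(\imath t\lambda_z^+)=\alpha+\beta$; and for every $z\in G_1\setminus X$, $\exp(\imath t\lambda_z^+)=\alpha-\beta$.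
   Context: $G$ is a finite abelian group of order $n$, written multiplicatively with identity $1$, identified with $\mathbb{Z}_{n_1}\otimes\cdots\otimes\mathbb{Z}_{n_r}$. For $z=(z_1,\dots,z_r)$ and $g=(g_1,\dots,g_r)$ in $G$, the character $\chi_z$ is $\chi_z(g)=\prod_{s=1}^r\omega_{n_s}^{z_sg_s}$ with $\omega_m=\exp(2\pi\imath/m)$; note $\chi_z(g)=\chi_g(z)$. For $Y\subseteq G$, $\chi_z(Y)=\sum_{y\in Y}\chi_z(y)$. $R,L,S\subseteq G$ with $R=R^{-1}$, $L=L^{-1}$, $1\notin R\cup L$. The semi-Cayley graph $\mathrm{SC}(G,R,L,S)$ has vertex set $\{(g,0),(g,1):g\in G\}$ and edges $\{(g,0),(h,0)\}$ for $hg^{-1}\in R$, $\{(g,1),(h,1)\}$ for $hg^{-1}\in L$, $\{(g,0),(h,1)\}$ for $hg^{-1}\in S$. For $z\in G$, $\lambda_z^\pm=\frac12\left(\chi_z(R)+\chi_z(L)\pm\sqrt{(\chi_z(R)-\chi_z(L))^2+4|\chi_z(S)|^2}\right)$. The transition matrix is $H(t)=\exp(\imath tA)$, $A$ the adjacency matrix. For distinct vertices $u,v$, $(\alpha,\beta)$-revival occurs from $u$ to $v$ at time $t$ if $H(t)\mathbf{e}_u=\alpha\mathbf{e}_u+\beta\mathbf{e}_v$ with $|\alpha|^2+|\beta|^2=1$.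
   Formalization: For z in X, the square root in λ_z^± is taken as χ_z(R)−χ_z(L), whatever its sign, so λ_z^-=χ_z(L) and λ_z^+=χ_z(R); with the nonnegative root the claim fails, e.g. for G=Z_2, R=S=∅, L={a}. *)

theory Defs
  imports Complex_Main "HOL-Algebra.Multiplicative_Group" "HOL-Algebra.Product_Groups"
begin

section \<open>Characters of a finite abelian group\<close>

text \<open>
  The identification of \<open>G\<close> with a product of cyclic groups of orders \<open>m 1, ..., m r\<close> is an
  explicit isomorphism \<open>\<phi>\<close>; then \<open>\<phi> g s\<close>, an integer in \<open>{0..<int (m s)}\<close>, is the
  \<open>s\<close>-th coordinate of \<open>g\<close>.
\<close>

definition cyclic_decomposition ::
  "('a, 'b) monoid_scheme \<Rightarrow> nat \<Rightarrow> (nat \<Rightarrow> nat) \<Rightarrow> ('a \<Rightarrow> nat \<Rightarrow> int) \<Rightarrow> bool" where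
  "cyclic_decomposition G r m \<phi> \<longleftrightarrow>
     \<phi> \<in> iso G (product_group {1..r} (\<lambda>s. integer_mod_group (m s)))"

definition omega :: "nat \<Rightarrow> complex" where
  "omega k = exp (2 * of_real pi * \<i> / of_nat k)"

definition character ::
  "nat \<Rightarrow> (nat \<Rightarrow> nat) \<Rightarrow> ('a \<Rightarrow> nat \<Rightarrow> int) \<Rightarrow> 'a \<Rightarrow> 'a \<Rightarrow> complex" where
  "character r m \<phi> z g = (\<Prod>s\<in>{1..r}. omega (m s) powi (\<phi> z s * \<phi> g s))"

definition character_sum ::
  "nat \<Rightarrow> (nat \<Rightarrow> nat) \<Rightarrow> ('a \<Rightarrow> nat \<Rightarrow> int) \<Rightarrow> 'a \<Rightarrow> 'a set \<Rightarrow> complex" where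
  "character_sum r m \<phi> z Y = (\<Sum>y\<in>Y. character r m \<phi> z y)"


section \<open>Semi-Cayley graphs and their eigenvalues\<close>

definition semi_cayley_verts :: "('a, 'b) monoid_scheme \<Rightarrow> ('a \<times> nat) set" where
  "semi_cayley_verts G = carrier G \<times> {0, 1}"

definition semi_cayley_edges ::
  "('a, 'b) monoid_scheme \<Rightarrow> 'a set \<Rightarrow> 'a set \<Rightarrow> 'a set \<Rightarrow> ('a \<times> nat) set set" where
  "semi_cayley_edges G R L S =
     {{(g, 0), (h, 0)} | g h. g \<in> carrier G \<and> h \<in> carrier G \<and> h \<otimes>\<^bsub>G\<^esub> inv\<^bsub>G\<^esub> g \<in> R} \<union>
     {{(g, 1), (h, 1)} | g h. g \<in> carrier G \<and> h \<in> carrier G \<and> h \<otimes>\<^bsub>G\<^esub> inv\<^bsub>G\<^esub> g \<in> L} \<union>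
     {{(g, 0), (h, 1)} | g h. g \<in> carrier G \<and> h \<in> carrier G \<and> h \<otimes>\<^bsub>G\<^esub> inv\<^bsub>G\<^esub> g \<in> S}"

text \<open>
  The square root of \<open>(\<chi>\<^sub>z(R) - \<chi>\<^sub>z(L))\<^sup>2 + 4 |\<chi>\<^sub>z(S)|\<^sup>2\<close>. If \<open>\<chi>\<^sub>z(S) = 0\<close>, the radicand is the
  square of the real number \<open>\<chi>\<^sub>z(R) - \<chi>\<^sub>z(L)\<close> and the root taken is that number itself,
  whatever its sign. The \<open>z\<close>-block of the adjacency matrix is then diagonal, and this labels its
  eigenvalues by the layer on which they live: \<open>\<chi>\<^sub>z(R)\<close> (plus, layer 0) and \<open>\<chi>\<^sub>z(L)\<close> (minus,
  layer 1). With the nonnegative root the two labels would be swapped whenever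
  \<open>\<chi>\<^sub>z(R) < \<chi>\<^sub>z(L)\<close>. If \<open>\<chi>\<^sub>z(S) \<noteq> 0\<close>, the radicand is a positive real (for inverse-closed
  \<open>R\<close> and \<open>L\<close>) and the root is the positive one.
\<close>

definition semi_cayley_root ::
  "nat \<Rightarrow> (nat \<Rightarrow> nat) \<Rightarrow> ('a \<Rightarrow> nat \<Rightarrow> int) \<Rightarrow> 'a set \<Rightarrow> 'a set \<Rightarrow> 'a set \<Rightarrow> 'a \<Rightarrow> complex" where
  "semi_cayley_root r m \<phi> R L S z =
     (if character_sum r m \<phi> z S = 0
      then character_sum r m \<phi> z R - character_sum r m \<phi> z L
      else csqrt ((character_sum r m \<phi> z R - character_sum r m \<phi> z L)\<^sup>2
                  + 4 * of_real ((cmod (character_sum r m \<phi> z S))\<^sup>2)))"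

definition lambda_plus ::
  "nat \<Rightarrow> (nat \<Rightarrow> nat) \<Rightarrow> ('a \<Rightarrow> nat \<Rightarrow> int) \<Rightarrow> 'a set \<Rightarrow> 'a set \<Rightarrow> 'a set \<Rightarrow> 'a \<Rightarrow> complex" where
  "lambda_plus r m \<phi> R L S z =
     1 / 2 * (character_sum r m \<phi> z R + character_sum r m \<phi> z L + semi_cayley_root r m \<phi> R L S z)"

definition lambda_minus ::
  "nat \<Rightarrow> (nat \<Rightarrow> nat) \<Rightarrow> ('a \<Rightarrow> nat \<Rightarrow> int) \<Rightarrow> 'a set \<Rightarrow> 'a set \<Rightarrow> 'a set \<Rightarrow> 'a \<Rightarrow> complex" where
  "lambda_minus r m \<phi> R L S z =
     1 / 2 * (character_sum r m \<phi> z R + character_sum r m \<phi> z L - semi_cayley_root r m \<phi> R L S z)"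


section \<open>Transition matrix and revival\<close>

text \<open>
  Complex matrices and vectors indexed by a finite set \<open>V\<close> are functions, of which only the
  values on \<open>V\<close> matter.
\<close>

definition adjacency_matrix :: "'v set set \<Rightarrow> 'v \<Rightarrow> 'v \<Rightarrow> complex" where
  "adjacency_matrix E u v = (if {u, v} \<in> E then 1 else 0)"

primrec matrix_power :: "'v set \<Rightarrow> ('v \<Rightarrow> 'v \<Rightarrow> complex) \<Rightarrow> nat \<Rightarrow> 'v \<Rightarrow> 'v \<Rightarrow> complex" where
  "matrix_power V M 0 = (\<lambda>u v. if u = v then 1 else 0)"
| "matrix_power V M (Suc k) = (\<lambda>u v. \<Sum>w\<in>V. M u w * matrix_power V M k w v)"

definition matrix_exp :: "'v set \<Rightarrow> ('v \<Rightarrow> 'v \<Rightarrow> complex) \<Rightarrow> 'v \<Rightarrow> 'v \<Rightarrow> complex" where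
  "matrix_exp V M u v = suminf (\<lambda>k. matrix_power V M k u v / fact k)"

definition matrix_apply :: "'v set \<Rightarrow> ('v \<Rightarrow> 'v \<Rightarrow> complex) \<Rightarrow> ('v \<Rightarrow> complex) \<Rightarrow> 'v \<Rightarrow> complex" where
  "matrix_apply V M x u = (\<Sum>w\<in>V. M u w * x w)"

definition unit_vector :: "'v \<Rightarrow> 'v \<Rightarrow> complex" where
  "unit_vector u w = (if w = u then 1 else 0)"

definition transition_matrix :: "'v set \<Rightarrow> 'v set set \<Rightarrow> real \<Rightarrow> 'v \<Rightarrow> 'v \<Rightarrow> complex" where
  "transition_matrix V E t = matrix_exp V (\<lambda>u v. \<i> * of_real t * adjacency_matrix E u v)"

definition revival_occurs ::
  "'v set \<Rightarrow> 'v set set \<Rightarrow> complex \<Rightarrow> complex \<Rightarrow> 'v \<Rightarrow> 'v \<Rightarrow> real \<Rightarrow> bool" where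
  "revival_occurs V E \<alpha> \<beta> u v t \<longleftrightarrow>
     u \<in> V \<and> v \<in> V \<and> u \<noteq> v \<and>
     (\<forall>w\<in>V. matrix_apply V (transition_matrix V E t) (unit_vector u) w
             = \<alpha> * unit_vector u w + \<beta> * unit_vector v w) \<and>
     (cmod \<alpha>)\<^sup>2 + (cmod \<beta>)\<^sup>2 = 1"

end

theory Submission
  imports Defs
begin

text \<open>
  The character \<open>\<chi>\<^sub>z\<close>, put on both layers with weights \<open>p\<close> and \<open>q\<close>, is an eigenvector of the adjacency
  matrix as soon as \<open>(p, q)\<close> is an eigenvector of a Hermitian \<open>2 \<times> 2\<close> block, and by Fourier inversion
  these eigenvectors determine a column of \<open>H(t)\<close>. Revival from \<open>(g, 1)\<close> to \<open>(h, 1)\<close> therefore means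
  that \<open>exp (\<i>t\<lambda>) = \<alpha> + \<beta> \<chi>\<^sub>z(a)\<close> for every eigenvalue \<open>\<lambda>\<close> of the \<open>z\<close>-block whose eigenvector does not
  vanish on layer 1; the only exceptions are the \<open>\<lambda>\<^sub>z\<^sup>+\<close> with \<open>z \<in> X\<close>. The eigenvalues are real, so
  \<open>|\<alpha> + \<beta> \<chi>\<^sub>z(a)| = 1 = |\<alpha>|\<^sup>2 + |\<beta>|\<^sup>2\<close> for all \<open>z\<close>. Taking \<open>z = 1\<close>, the product of \<open>\<beta>\<close> with the conjugate of
  \<open>\<alpha>\<close> is purely imaginary; then every \<open>\<chi>\<^sub>z(a)\<close> is real, so it is \<open>\<plusminus>1\<close>, and \<open>a\<close> is an involution.
\<close>

section \<open>Exponentials of finite matrices\<close>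

text \<open>The sum of all entry norms dominates every row sum, so each further factor
  \<open>M\<close> costs at most that constant. This crude bound allows comparison with the scalar
  exponential series.\<close>

lemma norm_matrix_power_le:
  assumes "finite V" and "u \<in> V"
  shows "norm (matrix_power V M k u v) \<le> (\<Sum>x\<in>V. \<Sum>y\<in>V. norm (M x y)) ^ k"
  using \<open>u \<in> V\<close>
proof (induction k arbitrary: u)
  case 0
  then show ?case by simp
next
  case (Suc k)
  define C where "C = (\<Sum>x\<in>V. \<Sum>y\<in>V. norm (M x y))"
  have C: "0 \<le> C"
    unfolding C_def by (intro sum_nonneg) simp
  have row: "(\<Sum>w\<in>V. norm (M u w)) \<le> C"
    unfolding C_def using assms(1) Suc.prems
    by (intro member_le_sum[where f = "\<lambda>x. \<Sum>y\<in>V. norm (M x y)"]) (auto intro: sum_nonneg)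
  have "norm (matrix_power V M (Suc k) u v) \<le> (\<Sum>w\<in>V. norm (M u w) * norm (matrix_power V M k w v))"
    by (simp add: norm_mult[symmetric] norm_sum)
  also have "\<dots> \<le> (\<Sum>w\<in>V. norm (M u w) * C ^ k)"
    using Suc.IH by (intro sum_mono mult_left_mono) (auto simp: C_def)
  also have "\<dots> = (\<Sum>w\<in>V. norm (M u w)) * C ^ k"
    by (simp add: sum_distrib_right)
  also have "\<dots> \<le> C * C ^ k"
    using row C by (intro mult_right_mono) auto
  finally show ?case
    by (simp add: C_def)
qed

lemma summable_matrix_exp:
  assumes "finite V" and "u \<in> V"
  shows "summable (\<lambda>k. matrix_power V M k u v / fact k)"
proof -
  define C where "C = (\<Sum>x\<in>V. \<Sum>y\<in>V. norm (M x y))"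
  have "summable (\<lambda>k. inverse (fact k) * C ^ k)"
    by (rule summable_exp)
  moreover have "norm (matrix_power V M k u v / fact k) \<le> inverse (fact k) * C ^ k" for k
    using norm_matrix_power_le[OF assms, of M k v]
    by (simp add: norm_divide C_def field_simps)
  ultimately show ?thesis
    by (rule summable_comparison_test'[where N = 0])
qed

lemma matrix_power_left_eigenvector:
  assumes "finite V" and "\<And>v. v \<in> V \<Longrightarrow> (\<Sum>u\<in>V. f u * M u v) = \<mu> * f v" and "v \<in> V"
  shows "(\<Sum>u\<in>V. f u * matrix_power V M k u v) = \<mu> ^ k * f v"
proof (induction k)
  case 0
  show ?case using assms(1,3) by (simp add: if_distrib sum.delta cong: if_cong)
next
  case (Suc k)
  have "(\<Sum>u\<in>V. f u * matrix_power V M (Suc k) u v)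
      = (\<Sum>w\<in>V. (\<Sum>u\<in>V. f u * M u w) * matrix_power V M k w v)"
    by (simp add: sum_distrib_left sum_distrib_right mult.assoc) (rule sum.swap)
  also have "\<dots> = \<mu> * (\<Sum>w\<in>V. f w * matrix_power V M k w v)"
    using assms(2) by (simp add: sum_distrib_left mult.assoc)
  finally show ?case
    using Suc.IH by simp
qed

text \<open>Left eigenvectors are used because they pair with a column of the exponential, and
  revival is a condition on a single column. The relation for powers is summed termwise.\<close>

lemma matrix_exp_left_eigenvector:
  assumes "finite V" and "\<And>v. v \<in> V \<Longrightarrow> (\<Sum>u\<in>V. f u * M u v) = \<mu> * f v" and "v \<in> V"
  shows "(\<Sum>u\<in>V. f u * matrix_exp V M u v) = exp \<mu> * f v"
proof -
  have "(\<lambda>k. \<Sum>u\<in>V. f u * (matrix_power V M k u v / fact k))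
      sums (\<Sum>u\<in>V. f u * matrix_exp V M u v)"
    unfolding matrix_exp_def
    by (intro sums_sum sums_mult summable_sums summable_matrix_exp assms(1))
  moreover have "(\<Sum>u\<in>V. f u * (matrix_power V M k u v / fact k)) = (\<mu> ^ k /\<^sub>R fact k) * f v" for k
    using matrix_power_left_eigenvector[OF assms, of k]
    by (simp add: sum_divide_distrib[symmetric] scaleR_conv_of_real field_simps)
  moreover have "(\<lambda>k. (\<mu> ^ k /\<^sub>R fact k) * f v) sums (exp \<mu> * f v)"
    by (intro sums_mult2 exp_converges)
  ultimately show ?thesis
    by (auto dest: sums_unique2)
qed

lemma matrix_apply_unit_vector:
  assumes "finite V" and "u \<in> V"
  shows "matrix_apply V M (unit_vector u) w = M w u"
  using assms by (simp add: matrix_apply_def unit_vector_def if_distrib sum.delta cong: if_cong)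

section \<open>Characters\<close>

lemma norm_omega [simp]: "norm (omega k) = 1"
  by (simp add: omega_def norm_exp_eq_Re Re_divide_of_nat)

lemma omega_nonzero [simp]: "omega k \<noteq> 0"
  by (simp add: omega_def)

lemma omega_powi: "omega k powi i = cis (2 * pi * of_int i / of_nat k)"
proof -
  have "omega k = cis (2 * pi / of_nat k)"
    by (simp add: omega_def cis_conv_exp mult_ac)
  then show ?thesis
    by (simp add: cis_power_int mult_ac)
qed

lemma omega_powi_mod: "omega k powi (i mod int k) = omega k powi i" if "k > 0"
proof -
  have "omega k powi (int k) = 1"
    using that by (simp add: omega_def exp_of_nat_mult[symmetric])
  then have "omega k powi (int k * (i div int k) + i mod int k) = omega k powi (i mod int k)"
    by (subst power_int_add) (simp_all add: power_int_mult del: mult_div_mod_eq)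
  then show ?thesis by simp
qed

lemma omega_powi_eq_1_iff:
  assumes "k > 0"
  shows "omega k powi i = 1 \<longleftrightarrow> int k dvd i"
proof
  assume "int k dvd i"
  then show "omega k powi i = 1"
    using omega_powi_mod[OF assms, of i] by simp
next
  assume "omega k powi i = 1"
  then have "cos (2 * pi * of_int i / of_nat k) = 1"
    by (simp add: omega_powi complex_eq_iff)
  then obtain j :: int where "2 * pi * of_int i / of_nat k = of_int j * 2 * pi"
    by (auto simp: cos_one_2pi_int)
  then have "real_of_int i = real_of_int (int k * j)"
    using assms by (simp add: field_simps)
  then show "int k dvd i"
    by (metis dvd_triv_left of_int_eq_iff)
qed

section \<open>Characters in coordinates\<close>

locale finite_comm_group_decomposition = comm_group G for G (structure) +
  fixes r :: nat and m :: "nat \<Rightarrow> nat" and \<phi> :: "'a \<Rightarrow> nat \<Rightarrow> int"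
  assumes fin: "finite (carrier G)" and decomp: "cyclic_decomposition G r m \<phi>"
begin

abbreviation \<chi> where "\<chi> \<equiv> character r m \<phi>"
abbreviation \<chi>s where "\<chi>s \<equiv> character_sum r m \<phi>"

lemma coord_bij:
  "bij_betw \<phi> (carrier G) (\<Pi>\<^sub>E s\<in>{1..r}. carrier (integer_mod_group (m s)))"
  using decomp by (simp add: cyclic_decomposition_def iso_def)

lemma coord_mult:
  assumes "x \<in> carrier G" and "y \<in> carrier G" and "s \<in> {1..r}"
  shows "\<phi> (x \<otimes> y) s = (\<phi> x s + \<phi> y s) mod int (m s)"
  using decomp assms by (auto simp: cyclic_decomposition_def iso_def hom_def mult_integer_mod_group)

text \<open>\<open>integer_mod_group 0\<close> is the infinite group of integers. Since no factor is
  empty, one such factor would make the whole product infinite, contradicting finiteness of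
  \<open>G\<close>.\<close>

lemma m_pos:
  assumes "s \<in> {1..r}"
  shows "m s > 0"
proof (rule ccontr)
  assume "\<not> m s > 0"
  then have "infinite (carrier (integer_mod_group (m s)))"
    by (simp add: carrier_integer_mod_group)
  moreover have "finite (\<Pi>\<^sub>E s\<in>{1..r}. carrier (integer_mod_group (m s)))"
    using coord_bij fin bij_betw_finite by blast
  moreover have "carrier (integer_mod_group (m s)) \<noteq> {}" for s
    by (simp add: carrier_integer_mod_group)
  ultimately show False
    using assms by (auto simp: finite_PiE_iff PiE_eq_empty_iff)
qed

lemma character_commute: "\<chi> z x = \<chi> x z"
  by (simp add: character_def mult.commute)

text \<open>Coordinates add only modulo \<open>m s\<close>, which is harmless because
  \<open>omega (m s)\<close> has period \<open>m s\<close> as a function of the exponent.\<close>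

lemma character_mult:
  assumes "x \<in> carrier G" and "y \<in> carrier G"
  shows "\<chi> z (x \<otimes> y) = \<chi> z x * \<chi> z y"
proof -
  have "omega (m s) powi (\<phi> z s * \<phi> (x \<otimes> y) s)
      = omega (m s) powi (\<phi> z s * \<phi> x s) * omega (m s) powi (\<phi> z s * \<phi> y s)"
    if s: "s \<in> {1..r}" for s
  proof -
    have "omega (m s) powi (\<phi> z s * \<phi> (x \<otimes> y) s)
        = omega (m s) powi ((\<phi> z s * \<phi> (x \<otimes> y) s) mod int (m s))"
      using omega_powi_mod[OF m_pos[OF s]] by simp
    also have "(\<phi> z s * \<phi> (x \<otimes> y) s) mod int (m s) = (\<phi> z s * (\<phi> x s + \<phi> y s)) mod int (m s)"
      by (simp add: coord_mult[OF assms s] mod_mult_right_eq)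
    also have "omega (m s) powi \<dots> = omega (m s) powi (\<phi> z s * (\<phi> x s + \<phi> y s))"
      using omega_powi_mod[OF m_pos[OF s]] by simp
    finally show ?thesis
      by (simp add: distrib_left power_int_add)
  qed
  then show ?thesis
    by (simp add: character_def prod.distrib)
qed

lemma norm_character [simp]: "norm (\<chi> z x) = 1"
  by (simp add: character_def norm_power_int flip: prod_norm)

lemma character_nonzero [simp]: "\<chi> z x \<noteq> 0"
  using norm_character[of z x] by (metis norm_zero zero_neq_one)

lemma character_one [simp]: "\<chi> z \<one> = 1"
  using character_mult[of \<one> \<one> z] by simp

lemma character_inv:
  assumes "x \<in> carrier G"
  shows "\<chi> z (inv x) = cnj (\<chi> z x)"
proof -
  have "\<chi> z x * \<chi> z (inv x) = 1"
    using character_mult[of x "inv x" z] assms by simp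
  moreover have "\<chi> z x * cnj (\<chi> z x) = 1"
    by (simp add: complex_norm_square[symmetric])
  ultimately show ?thesis
    by (metis character_nonzero mult_left_cancel)
qed

text \<open>Some coordinate \<open>s\<close> separates \<open>x\<close> from the identity. The
  element with coordinate 1 at \<open>s\<close> and 0 elsewhere gives a character that reads off
  exactly this coordinate.\<close>

lemma exists_nontrivial_character:
  assumes "x \<in> carrier G" and "x \<noteq> \<one>"
  obtains z where "z \<in> carrier G" and "\<chi> z x \<noteq> 1"
proof -
  have coord_in: "\<phi> y \<in> (\<Pi>\<^sub>E s\<in>{1..r}. {0..<int (m s)})" if "y \<in> carrier G" for y
    using bij_betw_apply[OF coord_bij that] m_pos
    by (force simp: PiE_iff carrier_integer_mod_group split: if_splits)
  have "\<phi> x \<noteq> \<phi> \<one>"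
    using coord_bij assms by (auto simp: bij_betw_def inj_on_def)
  then obtain s where s: "s \<in> {1..r}" and ne: "\<phi> x s \<noteq> \<phi> \<one> s"
    using coord_in[OF assms(1)] coord_in[OF one_closed] by (meson PiE_ext)
  have range: "0 \<le> \<phi> y s \<and> \<phi> y s < int (m s)" if "y \<in> carrier G" for y
    using coord_in[OF that] s by (auto simp: PiE_iff)
  \<comment> \<open>The identity is idempotent, so its coordinate is a residue equal to its own
    double, hence 0.\<close>
  have "\<phi> \<one> s = (\<phi> \<one> s + \<phi> \<one> s) mod int (m s)"
    using coord_mult[OF one_closed one_closed s] by simp
  then have "(\<phi> \<one> s + \<phi> \<one> s) mod int (m s) = \<phi> \<one> s mod int (m s)"
    using range[OF one_closed] by simp
  then have "int (m s) dvd \<phi> \<one> s"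
    by (simp add: mod_eq_dvd_iff)
  then have one: "\<phi> \<one> s = 0"
    using range[OF one_closed] by (meson linorder_not_less order_le_less zdvd_imp_le)
  have bounds: "0 < \<phi> x s" "\<phi> x s < int (m s)"
    using range[OF assms(1)] ne one by auto
  \<comment> \<open>The value 1 is a legal residue because \<open>bounds\<close> forces
    \<open>m s > 1\<close>; the restricted abstraction makes \<open>e\<close> extensional, as
    membership in the product requires.\<close>
  define e where "e = (\<lambda>i\<in>{1..r}. if i = s then 1 else 0 :: int)"
  have "e \<in> (\<Pi>\<^sub>E s\<in>{1..r}. carrier (integer_mod_group (m s)))"
    using bounds m_pos by (auto simp: e_def carrier_integer_mod_group)
  then obtain z where z: "z \<in> carrier G" "\<phi> z = e"
    using coord_bij by (metis bij_betw_iff_bijections)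
  have "\<chi> z x = (\<Prod>i\<in>{1..r}. if i = s then omega (m s) powi \<phi> x s else 1)"
    unfolding character_def z(2) by (intro prod.cong) (auto simp: e_def)
  also have "\<dots> = omega (m s) powi \<phi> x s"
    using s by (simp add: prod.delta)
  also have "\<dots> \<noteq> 1"
    using bounds m_pos[OF s] by (auto simp: omega_powi_eq_1_iff dest: zdvd_imp_le)
  finally show ?thesis
    using that z(1) by blast
qed

section \<open>Orthogonality and Fourier inversion\<close>

lemma sum_translate:
  assumes "y \<in> carrier G"
  shows "(\<Sum>x\<in>carrier G. f (x \<otimes> y)) = (\<Sum>x\<in>carrier G. f x)"
  by (rule sum.reindex_bij_witness[of _ "\<lambda>x. x \<otimes> inv y" "\<lambda>x. x \<otimes> y"])
     (use assms in \<open>auto simp: m_assoc\<close>)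

text \<open>Translating the index by \<open>z0\<close> permutes the group but multiplies the sum by
  \<open>\<chi> z0 x\<close>, so the sum vanishes once this factor differs from 1. Symmetry in
  \<open>z\<close> and \<open>x\<close> turns the index translation into a product.\<close>

lemma character_orthogonality:
  assumes "x \<in> carrier G"
  shows "(\<Sum>z\<in>carrier G. \<chi> z x) = (if x = \<one> then of_nat (card (carrier G)) else 0)"
proof (cases "x = \<one>")
  case False
  then obtain z0 where z0: "z0 \<in> carrier G" "\<chi> z0 x \<noteq> 1"
    using exists_nontrivial_character assms by blast
  have "(\<Sum>z\<in>carrier G. \<chi> z x) = (\<Sum>z\<in>carrier G. \<chi> (z \<otimes> z0) x)"
    using sum_translate[OF z0(1), of "\<lambda>z. \<chi> z x"] by simp
  also have "\<dots> = (\<Sum>z\<in>carrier G. \<chi> z x) * \<chi> z0 x"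
    using z0(1) by (simp add: character_commute[of _ x] character_mult sum_distrib_right)
  finally show ?thesis
    using z0(2) False by simp
qed simp

lemma fourier_inversion:
  assumes "y \<in> carrier G"
  shows "(\<Sum>z\<in>carrier G. \<chi> z (inv y) * (\<Sum>x\<in>carrier G. \<chi> z x * d x))
       = of_nat (card (carrier G)) * d y"
proof -
  have "(\<Sum>z\<in>carrier G. \<chi> z (inv y) * (\<Sum>x\<in>carrier G. \<chi> z x * d x))
      = (\<Sum>z\<in>carrier G. \<Sum>x\<in>carrier G. \<chi> z (x \<otimes> inv y) * d x)"
    using assms by (simp add: character_mult sum_distrib_left mult_ac)
  also have "\<dots> = (\<Sum>x\<in>carrier G. (\<Sum>z\<in>carrier G. \<chi> z (x \<otimes> inv y)) * d x)"
    by (subst sum.swap) (simp add: sum_distrib_right)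
  also have "\<dots> = (\<Sum>x\<in>carrier G. if x = y then of_nat (card (carrier G)) * d x else 0)"
  proof (intro sum.cong refl)
    fix x assume x: "x \<in> carrier G"
    have "x \<otimes> inv y = \<one> \<longleftrightarrow> x = y"
      using x assms by (metis inv_closed inv_equality inv_inv r_inv)
    then show "(\<Sum>z\<in>carrier G. \<chi> z (x \<otimes> inv y)) * d x
        = (if x = y then of_nat (card (carrier G)) * d x else 0)"
      using x assms by (simp add: character_orthogonality)
  qed
  also have "\<dots> = of_nat (card (carrier G)) * d y"
    using assms fin by (simp add: sum.delta)
  finally show ?thesis .
qed

lemma fourier_injective:
  assumes "\<And>z. z \<in> carrier G \<Longrightarrow> (\<Sum>x\<in>carrier G. \<chi> z x * d x) = 0" and "y \<in> carrier G"
  shows "d y = 0"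
proof -
  have "of_nat (card (carrier G)) * d y = 0"
    using fourier_inversion[OF assms(2), of d] assms(1) by simp
  then show ?thesis
    using fin assms(2) by (auto simp: card_eq_0_iff)
qed

text \<open>Each block of the adjacency matrix is a translation-invariant 0-1 matrix; such a matrix
  acts on a character by a scalar, the character sum of its connection set.\<close>

lemma sum_character_translate:
  assumes "Y \<subseteq> carrier G" and "y \<in> carrier G"
  shows "(\<Sum>x\<in>carrier G. \<chi> z x * of_bool (x \<otimes> inv y \<in> Y)) = \<chi>s z Y * \<chi> z y"
proof -
  have "(\<Sum>x\<in>carrier G. \<chi> z x * of_bool (x \<otimes> inv y \<in> Y))
      = (\<Sum>x\<in>carrier G. \<chi> z (x \<otimes> y) * of_bool (x \<otimes> y \<otimes> inv y \<in> Y))"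
    using sum_translate[OF assms(2), of "\<lambda>x. \<chi> z x * of_bool (x \<otimes> inv y \<in> Y)"] by simp
  also have "\<dots> = (\<Sum>x\<in>carrier G. if x \<in> Y then \<chi> z x * \<chi> z y else 0)"
    using assms by (intro sum.cong) (auto simp: m_assoc character_mult)
  also have "\<dots> = (\<Sum>x\<in>Y. \<chi> z x * \<chi> z y)"
    using assms fin by (simp add: sum.inter_restrict[symmetric] Int_absorb1)
  finally show ?thesis
    by (simp add: character_sum_def sum_distrib_right)
qed

text \<open>This serves the block from layer 0 to layer 1, where the quotient is reversed.
  Substituting inverses conjugates the characters and hence the scalar.\<close>

lemma sum_character_reflect:
  assumes "Y \<subseteq> carrier G" and "y \<in> carrier G"
  shows "(\<Sum>x\<in>carrier G. \<chi> z x * of_bool (y \<otimes> inv x \<in> Y)) = cnj (\<chi>s z Y) * \<chi> z y"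
proof -
  have "(\<Sum>x\<in>carrier G. \<chi> z x * of_bool (y \<otimes> inv x \<in> Y))
      = (\<Sum>x\<in>carrier G. \<chi> z (inv x) * of_bool (x \<otimes> inv (inv y) \<in> Y))"
    by (rule sum.reindex_bij_witness[of _ "\<lambda>x. inv x" "\<lambda>x. inv x"])
       (use assms in \<open>auto simp: m_comm\<close>)
  also have "\<dots> = cnj (\<Sum>x\<in>carrier G. \<chi> z x * of_bool (x \<otimes> inv (inv y) \<in> Y))"
    by (simp add: character_inv of_bool_def if_distrib cong: if_cong)
  also have "\<dots> = cnj (\<chi>s z Y) * \<chi> z y"
    using assms by (subst sum_character_translate) (auto simp: character_inv)
  finally show ?thesis .
qed

lemma cnj_character_sum:
  assumes "Y \<subseteq> carrier G" and "set_inv Y = Y"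
  shows "cnj (\<chi>s z Y) = \<chi>s z Y"
proof -
  have inv_mem: "inv x \<in> Y" if "x \<in> Y" for x
    using assms(2) that by (auto simp: SET_INV_def)
  have "cnj (\<chi>s z Y) = (\<Sum>y\<in>Y. \<chi> z (inv y))"
    using assms(1) by (auto simp: character_sum_def character_inv intro!: sum.cong)
  also have "\<dots> = (\<Sum>y\<in>Y. \<chi> z y)"
    by (rule sum.reindex_bij_witness[of _ "\<lambda>x. inv x" "\<lambda>x. inv x"])
       (use inv_mem assms(1) in auto)
  finally show ?thesis
    by (simp add: character_sum_def)
qed

end

section \<open>The spectrum of a semi-Cayley graph\<close>

locale semi_cayley_graph = finite_comm_group_decomposition +
  fixes R L S :: "'a set"
  assumes R_subset: "R \<subseteq> carrier G" and L_subset: "L \<subseteq> carrier G" and S_subset: "S \<subseteq> carrier G"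
    and R_inv: "set_inv R = R" and L_inv: "set_inv L = L"
begin

abbreviation V where "V \<equiv> semi_cayley_verts G"
abbreviation E where "E \<equiv> semi_cayley_edges G R L S"
abbreviation root where "root \<equiv> semi_cayley_root r m \<phi> R L S"
abbreviation lam_plus where "lam_plus \<equiv> lambda_plus r m \<phi> R L S"
abbreviation lam_minus where "lam_minus \<equiv> lambda_minus r m \<phi> R L S"
abbreviation H where "H \<equiv> transition_matrix V E"

lemma finite_V: "finite V"
  using fin by (simp add: semi_cayley_verts_def)

lemma sum_verts: "(\<Sum>w\<in>V. f w) = (\<Sum>x\<in>carrier G. f (x, 0)) + (\<Sum>x\<in>carrier G. f (x, 1))"
proof -
  have "(\<Sum>w\<in>V. f w) = (\<Sum>x\<in>carrier G. \<Sum>j\<in>{0, 1}. f (x, j))"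
    unfolding semi_cayley_verts_def by (simp only: sum.cartesian_product case_prod_eta)
  then show ?thesis
    by (simp add: sum.distrib)
qed

lemma quotient_mem_commute:
  assumes "set_inv Y = Y" and "x \<in> carrier G" and "y \<in> carrier G"
  shows "x \<otimes> inv y \<in> Y \<longleftrightarrow> y \<otimes> inv x \<in> Y"
proof -
  have inv_mem: "inv w \<in> Y" if "w \<in> Y" for w
    using assms(1) that by (auto simp: SET_INV_def)
  have "inv (x \<otimes> inv y) = y \<otimes> inv x" "inv (y \<otimes> inv x) = x \<otimes> inv y"
    using assms(2,3) by (simp_all add: inv_mult_group)
  then show ?thesis
    using inv_mem by metis
qed

text \<open>Edges are unordered, so inside a layer either quotient may witness adjacency;
  inverse-closedness makes both tests agree. The connection set \<open>S\<close> is read from layer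
  0 to layer 1, hence the opposite quotients in the mixed entries.\<close>

lemma adjacency_semi_cayley:
  assumes "x \<in> carrier G" and "y \<in> carrier G"
  shows "adjacency_matrix E (x, 0) (y, 0) = of_bool (x \<otimes> inv y \<in> R)"
    and "adjacency_matrix E (x, 1) (y, 1) = of_bool (x \<otimes> inv y \<in> L)"
    and "adjacency_matrix E (x, 0) (y, 1) = of_bool (y \<otimes> inv x \<in> S)"
    and "adjacency_matrix E (x, 1) (y, 0) = of_bool (x \<otimes> inv y \<in> S)"
  using assms quotient_mem_commute[OF R_inv assms] quotient_mem_commute[OF L_inv assms]
  by (auto simp: adjacency_matrix_def semi_cayley_edges_def doubleton_eq_iff)

definition block_vector :: "'a \<Rightarrow> complex \<Rightarrow> complex \<Rightarrow> 'a \<times> nat \<Rightarrow> complex" where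
  "block_vector z p q w = (if snd w = 0 then p else q) * \<chi> z (fst w)"

text \<open>The first two hypotheses say that the row \<open>(p, q)\<close> is a left eigenvector of
  the Hermitian block with rows \<open>(\<chi>s z R, cnj (\<chi>s z S))\<close> and
  \<open>(\<chi>s z S, \<chi>s z L)\<close>.\<close>

lemma adjacency_block_vector:
  assumes "p * \<chi>s z R + q * \<chi>s z S = \<mu> * p" and "p * cnj (\<chi>s z S) + q * \<chi>s z L = \<mu> * q"
    and "v \<in> V"
  shows "(\<Sum>w\<in>V. block_vector z p q w * adjacency_matrix E w v) = \<mu> * block_vector z p q v"
proof -
  obtain y j where v: "v = (y, j)" "y \<in> carrier G" "j = 0 \<or> j = 1"
    using assms(3) by (auto simp: semi_cayley_verts_def)
  have S0: "(\<Sum>w\<in>V. block_vector z p q w * adjacency_matrix E w (y, 0))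
      = (p * \<chi>s z R + q * \<chi>s z S) * \<chi> z y"
  proof -
    have "(\<Sum>w\<in>V. block_vector z p q w * adjacency_matrix E w (y, 0))
      = p * (\<Sum>x\<in>carrier G. \<chi> z x * of_bool (x \<otimes> inv y \<in> R))
      + q * (\<Sum>x\<in>carrier G. \<chi> z x * of_bool (x \<otimes> inv y \<in> S))"
      unfolding sum_verts sum_distrib_left using v(2)
      by (intro arg_cong2[where f = plus] sum.cong refl)
        (simp_all only: adjacency_semi_cayley block_vector_def fst_conv snd_conv mult.assoc
          one_neq_zero if_True if_False simp_thms)
    then show ?thesis
      using v(2) R_subset S_subset by (simp add: sum_character_translate distrib_right)
  qed
  have S1: "(\<Sum>w\<in>V. block_vector z p q w * adjacency_matrix E w (y, 1))
      = (p * cnj (\<chi>s z S) + q * \<chi>s z L) * \<chi> z y"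
  proof -
    have "(\<Sum>w\<in>V. block_vector z p q w * adjacency_matrix E w (y, 1))
      = p * (\<Sum>x\<in>carrier G. \<chi> z x * of_bool (y \<otimes> inv x \<in> S))
      + q * (\<Sum>x\<in>carrier G. \<chi> z x * of_bool (x \<otimes> inv y \<in> L))"
      unfolding sum_verts sum_distrib_left using v(2)
      by (intro arg_cong2[where f = plus] sum.cong refl)
        (simp_all only: adjacency_semi_cayley block_vector_def fst_conv snd_conv mult.assoc
          one_neq_zero if_True if_False simp_thms)
    then show ?thesis
      using v(2) L_subset S_subset
      by (simp add: sum_character_translate sum_character_reflect distrib_right)
  qed
  from v(3) show ?thesis
  proof
    assume "j = 0"
    then show ?thesis
      using S0 assms(1) by (simp add: v(1) block_vector_def mult.assoc)
  next
    assume "j = 1"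
    then show ?thesis
      using S1 assms(2) by (simp add: v(1) block_vector_def mult.assoc)
  qed
qed

lemma transition_block_vector:
  assumes "p * \<chi>s z R + q * \<chi>s z S = \<mu> * p" and "p * cnj (\<chi>s z S) + q * \<chi>s z L = \<mu> * q"
    and "v \<in> V"
  shows "(\<Sum>w\<in>V. block_vector z p q w * H t w v) = exp (\<i> * of_real t * \<mu>) * block_vector z p q v"
  unfolding transition_matrix_def
proof (rule matrix_exp_left_eigenvector[OF finite_V _ assms(3)])
  fix u assume "u \<in> V"
  have "(\<Sum>w\<in>V. block_vector z p q w * (\<i> * of_real t * adjacency_matrix E w u))
      = \<i> * of_real t * (\<Sum>w\<in>V. block_vector z p q w * adjacency_matrix E w u)"
    by (simp add: sum_distrib_left mult_ac)
  then show "(\<Sum>w\<in>V. block_vector z p q w * (\<i> * of_real t * adjacency_matrix E w u))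
      = \<i> * of_real t * \<mu> * block_vector z p q u"
    using adjacency_block_vector[OF assms(1,2) \<open>u \<in> V\<close>] by simp
qed

text \<open>Both branches of the root square to the discriminant of the block, so the algebra of the
  eigenvalues needs no case split.\<close>

lemma root_squared: "(root z)\<^sup>2 = (\<chi>s z R - \<chi>s z L)\<^sup>2 + 4 * (\<chi>s z S * cnj (\<chi>s z S))"
  by (simp add: semi_cayley_root_def complex_norm_square del: of_real_power)

lemma character_sum_real:
  shows "\<chi>s z R = of_real (Re (\<chi>s z R))" and "\<chi>s z L = of_real (Re (\<chi>s z L))"
  using cnj_character_sum[OF R_subset R_inv, of z] cnj_character_sum[OF L_subset L_inv, of z]
  by (metis complex_is_Real_iff Reals_cnj_iff of_real_Re)+

text \<open>Inverse-closedness makes the radicand real. Realness of the root gives real eigenvalues;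
  its being nonzero keeps the two eigenvalues apart when \<open>\<chi>s z S\<close> is
  nonzero.\<close>

lemma root_real:
  obtains d where "root z = of_real d" and "\<chi>s z S \<noteq> 0 \<Longrightarrow> d \<noteq> 0"
proof (cases "\<chi>s z S = 0")
  case True
  then have "root z = of_real (Re (\<chi>s z R) - Re (\<chi>s z L))"
    using character_sum_real[of z] by (simp add: semi_cayley_root_def)
  then show ?thesis
    using that True by blast
next
  case False
  define D where "D = (Re (\<chi>s z R) - Re (\<chi>s z L))\<^sup>2 + 4 * (cmod (\<chi>s z S))\<^sup>2"
  have "0 < D"
    using False by (simp add: D_def add_nonneg_pos)
  have "root z = csqrt (of_real D)"
    using False character_sum_real[of z] by (simp add: semi_cayley_root_def D_def)
  also have "\<dots> = of_real (sqrt D)"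
    using \<open>0 < D\<close> by simp
  finally show ?thesis
    using that[of "sqrt D"] \<open>0 < D\<close> by simp
qed

text \<open>Stated for \<open>lam_minus\<close> because revival constrains its phase at every
  \<open>z\<close>, including those with \<open>\<chi>s z S = 0\<close>.\<close>

lemma norm_exp_lambda_minus: "cmod (exp (\<i> * of_real t * lam_minus z)) = 1"
proof -
  obtain d where d: "root z = of_real d"
    using root_real by blast
  have "Im (\<chi>s z R) = 0" "Im (\<chi>s z L) = 0"
    using character_sum_real[of z] by (metis Im_complex_of_real)+
  then have "Im (lam_minus z) = 0"
    by (simp add: lambda_minus_def d)
  then show ?thesis
    by (simp add: norm_exp_eq_Re)
qed

text \<open>The characteristic equation of the block.\<close>

lemma lambda_quadratic:
  shows "(lam_plus z - \<chi>s z R) * (lam_plus z - \<chi>s z L) = \<chi>s z S * cnj (\<chi>s z S)"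
    and "(lam_minus z - \<chi>s z R) * (lam_minus z - \<chi>s z L) = \<chi>s z S * cnj (\<chi>s z S)"
  using root_squared[of z]
  by (simp_all add: lambda_plus_def lambda_minus_def field_simps power2_eq_square)

text \<open>The signed root is what attaches plus to layer 0 and minus to layer 1, irrespective of
  which value is larger.\<close>

lemma lambda_layers:
  assumes "\<chi>s z S = 0"
  shows "lam_plus z = \<chi>s z R" and "lam_minus z = \<chi>s z L"
  using assms by (simp_all add: lambda_plus_def lambda_minus_def semi_cayley_root_def)

text \<open>With \<open>\<chi>s z S\<close> nonzero, the chosen weights satisfy the first
  eigenvector equation identically and the second by the characteristic equation. For
  \<open>\<chi>s z S = 0\<close> they would both vanish, so a coordinate vector replaces
  them.\<close>

definition plus_vector :: "'a \<Rightarrow> 'a \<times> nat \<Rightarrow> complex" where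
  "plus_vector z = (if \<chi>s z S = 0 then block_vector z 1 0
                    else block_vector z (\<chi>s z S) (lam_plus z - \<chi>s z R))"

definition minus_vector :: "'a \<Rightarrow> 'a \<times> nat \<Rightarrow> complex" where
  "minus_vector z = (if \<chi>s z S = 0 then block_vector z 0 1
                     else block_vector z (\<chi>s z S) (lam_minus z - \<chi>s z R))"

lemma transition_plus_vector:
  assumes "v \<in> V"
  shows "(\<Sum>w\<in>V. plus_vector z w * H t w v) = exp (\<i> * of_real t * lam_plus z) * plus_vector z v"
proof (cases "\<chi>s z S = 0")
  case True
  then show ?thesis
    using transition_block_vector[of 1 z 0 "lam_plus z" v t] lambda_layers(1)[of z] assms
    by (simp add: plus_vector_def)
next
  case False
  have "\<chi>s z S * \<chi>s z R + (lam_plus z - \<chi>s z R) * \<chi>s z S = lam_plus z * \<chi>s z S"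
    by (simp add: algebra_simps)
  moreover have "\<chi>s z S * cnj (\<chi>s z S) + (lam_plus z - \<chi>s z R) * \<chi>s z L
      = lam_plus z * (lam_plus z - \<chi>s z R)"
    unfolding lambda_quadratic(1)[symmetric] by (simp add: algebra_simps)
  ultimately show ?thesis
    using False transition_block_vector assms by (simp add: plus_vector_def)
qed

lemma transition_minus_vector:
  assumes "v \<in> V"
  shows "(\<Sum>w\<in>V. minus_vector z w * H t w v) = exp (\<i> * of_real t * lam_minus z) * minus_vector z v"
proof (cases "\<chi>s z S = 0")
  case True
  then show ?thesis
    using transition_block_vector[of 0 z 1 "lam_minus z" v t] lambda_layers(2)[of z] assms
    by (simp add: minus_vector_def)
next
  case False
  have "\<chi>s z S * \<chi>s z R + (lam_minus z - \<chi>s z R) * \<chi>s z S = lam_minus z * \<chi>s z S"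
    by (simp add: algebra_simps)
  moreover have "\<chi>s z S * cnj (\<chi>s z S) + (lam_minus z - \<chi>s z R) * \<chi>s z L
      = lam_minus z * (lam_minus z - \<chi>s z R)"
    unfolding lambda_quadratic(2)[symmetric] by (simp add: algebra_simps)
  ultimately show ?thesis
    using False transition_block_vector assms by (simp add: minus_vector_def)
qed

lemma sum_block_vector:
  "(\<Sum>w\<in>V. block_vector z p q w * d w)
     = p * (\<Sum>x\<in>carrier G. \<chi> z x * d (x, 0)) + q * (\<Sum>x\<in>carrier G. \<chi> z x * d (x, 1))"
  by (simp add: sum_verts block_vector_def sum_distrib_left mult.assoc)

text \<open>For each \<open>z\<close> the two weight pairs are linearly independent, so the Fourier
  coefficients of \<open>d\<close> on both layers vanish; Fourier inversion then gives
  \<open>d = 0\<close> on each layer.\<close>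

lemma eigenvectors_complete:
  assumes plus: "\<And>z. z \<in> carrier G \<Longrightarrow> (\<Sum>w\<in>V. plus_vector z w * d w) = 0"
    and minus: "\<And>z. z \<in> carrier G \<Longrightarrow> (\<Sum>w\<in>V. minus_vector z w * d w) = 0"
    and "w \<in> V"
  shows "d w = 0"
proof -
  define P where "P z = (\<Sum>x\<in>carrier G. \<chi> z x * d (x, 0))" for z
  define Q where "Q z = (\<Sum>x\<in>carrier G. \<chi> z x * d (x, 1))" for z
  have PQ: "P z = 0 \<and> Q z = 0" if z: "z \<in> carrier G" for z
  proof (cases "\<chi>s z S = 0")
    case True
    then show ?thesis
      using plus[OF z] minus[OF z]
      by (simp add: plus_vector_def minus_vector_def sum_block_vector P_def Q_def)
  next
    case False
    have eqs: "\<chi>s z S * P z + (lam_plus z - \<chi>s z R) * Q z = 0"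
      "\<chi>s z S * P z + (lam_minus z - \<chi>s z R) * Q z = 0"
      using False plus[OF z] minus[OF z]
      by (simp_all add: plus_vector_def minus_vector_def sum_block_vector P_def Q_def)
    \<comment> \<open>Subtracting the two equations eliminates \<open>P z\<close>; the remaining
      factor is the nonzero root.\<close>
    have "(lam_plus z - lam_minus z) * Q z
        = (\<chi>s z S * P z + (lam_plus z - \<chi>s z R) * Q z) - (\<chi>s z S * P z + (lam_minus z - \<chi>s z R) * Q z)"
      by (simp add: algebra_simps)
    then have "(lam_plus z - lam_minus z) * Q z = 0"
      by (simp only: eqs diff_self)
    moreover have "lam_plus z - lam_minus z = root z"
      by (simp add: lambda_plus_def lambda_minus_def field_simps)
    moreover have "root z \<noteq> 0"
      using False by (metis root_real of_real_eq_0_iff)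
    ultimately show ?thesis
      using eqs False by simp
  qed
  obtain y j where "w = (y, j)" "y \<in> carrier G" "j = 0 \<or> j = 1"
    using \<open>w \<in> V\<close> by (auto simp: semi_cayley_verts_def)
  then show ?thesis
    using fourier_injective[of "\<lambda>x. d (x, 0)" y] fourier_injective[of "\<lambda>x. d (x, 1)" y] PQ
    by (auto simp: P_def Q_def)
qed

section \<open>Revival\<close>

text \<open>Revival means that the defect \<open>d\<close> of the column at \<open>(g, 1)\<close>
  vanishes. By completeness it suffices to test \<open>d\<close> against the eigenvectors, and each
  test is one scalar equation.\<close>

lemma revival_iff_eigenvalues:
  assumes g: "g \<in> carrier G" and h: "h \<in> carrier G"
  shows "revival_occurs V E \<alpha> \<beta> (g, 1) (h, 1) t \<longleftrightarrow>
    g \<noteq> h \<and> (cmod \<alpha>)\<^sup>2 + (cmod \<beta>)\<^sup>2 = 1 \<and>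
    (\<forall>z\<in>carrier G. exp (\<i> * of_real t * lam_minus z) = \<alpha> + \<beta> * \<chi> z (inv g \<otimes> h) \<and>
      (\<chi>s z S \<noteq> 0 \<longrightarrow> exp (\<i> * of_real t * lam_plus z) = \<alpha> + \<beta> * \<chi> z (inv g \<otimes> h)))"
    (is "_ \<longleftrightarrow> _ \<and> _ \<and> ?eigen")
proof -
  have gV: "(g, 1) \<in> V" and hV: "(h, 1) \<in> V"
    using g h by (simp_all add: semi_cayley_verts_def)
  define d where "d w = H t w (g, 1) - (\<alpha> * unit_vector (g, 1) w + \<beta> * unit_vector (h, 1) w)" for w
  have "(\<Sum>w\<in>V. f w * d w) = (\<Sum>w\<in>V. f w * H t w (g, 1)) - (\<alpha> * f (g, 1) + \<beta> * f (h, 1))" for f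
  proof -
    have unit: "(\<Sum>w\<in>V. f w * unit_vector u w) = f u" if "u \<in> V" for u
      using that finite_V by (simp add: unit_vector_def if_distrib cong: if_cong)
    have "(\<Sum>w\<in>V. f w * d w) = (\<Sum>w\<in>V. f w * H t w (g, 1))
        - (\<alpha> * (\<Sum>w\<in>V. f w * unit_vector (g, 1) w) + \<beta> * (\<Sum>w\<in>V. f w * unit_vector (h, 1) w))"
      by (simp add: d_def algebra_simps sum.distrib sum_subtractf sum_distrib_left)
    then show ?thesis
      by (simp only: unit[OF gV] unit[OF hV])
  qed
  then have plus: "(\<Sum>w\<in>V. plus_vector z w * d w)
        = (exp (\<i> * of_real t * lam_plus z) - \<alpha>) * plus_vector z (g, 1) - \<beta> * plus_vector z (h, 1)"
    and minus: "(\<Sum>w\<in>V. minus_vector z w * d w)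
        = (exp (\<i> * of_real t * lam_minus z) - \<alpha>) * minus_vector z (g, 1) - \<beta> * minus_vector z (h, 1)" for z
    by (simp_all only: transition_plus_vector[OF gV] transition_minus_vector[OF gV])
       (simp_all add: algebra_simps)
  have "\<chi> z h = \<chi> z g * \<chi> z (inv g \<otimes> h)" for z
    using g h by (simp flip: character_mult m_assoc)
  \<comment> \<open>Both vertices lie on layer 1, so only the weight \<open>q\<close> enters; an
    eigenvector with \<open>q = 0\<close> imposes no condition.\<close>
  then have "(\<epsilon> - \<alpha>) * block_vector z p q (g, 1) - \<beta> * block_vector z p q (h, 1)
      = q * \<chi> z g * (\<epsilon> - (\<alpha> + \<beta> * \<chi> z (inv g \<otimes> h)))" for \<epsilon> z p q
    by (simp add: block_vector_def algebra_simps)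
  then have factor: "(\<epsilon> - \<alpha>) * block_vector z p q (g, 1) - \<beta> * block_vector z p q (h, 1) = 0
      \<longleftrightarrow> q = 0 \<or> \<epsilon> = \<alpha> + \<beta> * \<chi> z (inv g \<otimes> h)" for \<epsilon> z p q
    by (simp only: mult_eq_0_iff character_nonzero right_minus_eq simp_thms)
  \<comment> \<open>By the characteristic equation these layer 1 weights divide the squared norm of
    \<open>\<chi>s z S\<close>, which is nonzero.\<close>
  have nz: "lam_plus z - \<chi>s z R \<noteq> 0" "lam_minus z - \<chi>s z R \<noteq> 0" if "\<chi>s z S \<noteq> 0" for z
    using lambda_quadratic[of z] that by auto
  have plus_iff: "(\<Sum>w\<in>V. plus_vector z w * d w) = 0 \<longleftrightarrow>
      (\<chi>s z S \<noteq> 0 \<longrightarrow> exp (\<i> * of_real t * lam_plus z) = \<alpha> + \<beta> * \<chi> z (inv g \<otimes> h))" for z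
    unfolding plus using nz(1)[of z] by (simp add: plus_vector_def factor del: One_nat_def right_minus_eq)
  have minus_iff: "(\<Sum>w\<in>V. minus_vector z w * d w) = 0 \<longleftrightarrow>
      exp (\<i> * of_real t * lam_minus z) = \<alpha> + \<beta> * \<chi> z (inv g \<otimes> h)" for z
    unfolding minus using nz(2)[of z] by (simp add: minus_vector_def factor del: One_nat_def right_minus_eq)
  have "(\<forall>w\<in>V. d w = 0) \<longleftrightarrow> ?eigen"
  proof
    assume "\<forall>w\<in>V. d w = 0"
    then have "(\<Sum>w\<in>V. f w * d w) = 0" for f
      by simp
    then show ?eigen
      using plus_iff minus_iff by simp
  next
    assume ?eigen
    then show "\<forall>w\<in>V. d w = 0"
      using eigenvectors_complete[of d] plus_iff minus_iff by blast
  qed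
  moreover have "(\<forall>w\<in>V. d w = 0) \<longleftrightarrow> (\<forall>w\<in>V. matrix_apply V (H t) (unit_vector (g, 1)) w
      = \<alpha> * unit_vector (g, 1) w + \<beta> * unit_vector (h, 1) w)"
    by (simp only: matrix_apply_unit_vector[OF finite_V gV] d_def right_minus_eq)
  ultimately show ?thesis
    using gV hV by (auto simp only: revival_occurs_def prod.inject)
qed

end

text \<open>The number \<open>c\<close> enters only through the cross term, so unit norm of the sum
  together with the normalisation of \<alpha> and \<beta> makes that term vanish.\<close>

lemma norm_add_unit_mult:
  assumes "cmod c = 1"
  shows "(cmod (\<alpha> + \<beta> * c))\<^sup>2 = (cmod \<alpha>)\<^sup>2 + (cmod \<beta>)\<^sup>2 + 2 * Re (cnj \<alpha> * \<beta> * c)"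
proof -
  have "(cmod (\<alpha> + \<beta> * c))\<^sup>2 = (cmod \<alpha>)\<^sup>2 + (cmod (\<beta> * c))\<^sup>2 + 2 * Re (cnj \<alpha> * (\<beta> * c))"
    by (simp only: cmod_power2) (simp add: power2_eq_square algebra_simps)
  then show ?thesis
    using assms by (simp add: norm_mult mult.assoc)
qed

lemma unit_circle_real_cases:
  assumes "cmod c = 1" and "Im c = 0"
  shows "c = 1 \<or> c = -1"
proof -
  have "c = of_real (Re c)"
    using assms(2) by (simp add: complex_eq_iff)
  moreover have "\<bar>Re c\<bar> = 1"
    using assms calculation by (metis norm_of_real)
  ultimately show ?thesis
    by (auto simp: abs_if complex_eq_iff split: if_splits)
qed

theorem theorem3p6:
  fixes G :: "('a, 'b) monoid_scheme"
    and n r :: nat and m :: "nat \<Rightarrow> nat" and \<phi> :: "'a \<Rightarrow> nat \<Rightarrow> int"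
    and R L S X G0 G1 :: "'a set" and g h a :: 'a
    and \<alpha> \<beta> :: complex and t :: real
  assumes "comm_group G" and "finite (carrier G)" and "order G = n"
    and "cyclic_decomposition G r m \<phi>"
    and "R \<subseteq> carrier G" and "L \<subseteq> carrier G" and "S \<subseteq> carrier G"
    and "set_inv\<^bsub>G\<^esub> R = R" and "set_inv\<^bsub>G\<^esub> L = L"
    and "\<one>\<^bsub>G\<^esub> \<notin> R \<union> L"
    and "\<alpha> \<noteq> 0" and "\<beta> \<noteq> 0"
    and "g \<in> carrier G" and "h \<in> carrier G"
    and "X = {z \<in> carrier G. character_sum r m \<phi> z S = 0}"
    and "a = inv\<^bsub>G\<^esub> g \<otimes>\<^bsub>G\<^esub> h"
    and "G0 = {z \<in> carrier G. character r m \<phi> a z = 1}"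
    and "G1 = {z \<in> carrier G. character r m \<phi> a z = -1}"
  shows "revival_occurs (semi_cayley_verts G) (semi_cayley_edges G R L S) \<alpha> \<beta> (g, 1) (h, 1) t
     \<longleftrightarrow>
       (group.ord G a = 2 \<and> even n) \<and>
       ((\<forall>z\<in>G0. exp (\<i> * of_real t * lambda_minus r m \<phi> R L S z) = \<alpha> + \<beta>) \<and>
        (\<forall>z\<in>G1. exp (\<i> * of_real t * lambda_minus r m \<phi> R L S z) = \<alpha> - \<beta>) \<and>
        (\<forall>z\<in>G0 - X. exp (\<i> * of_real t * lambda_plus r m \<phi> R L S z) = \<alpha> + \<beta>) \<and>
        (\<forall>z\<in>G1 - X. exp (\<i> * of_real t * lambda_plus r m \<phi> R L S z) = \<alpha> - \<beta>))"
    (is "?revival \<longleftrightarrow> ?order \<and> ?spectrum")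
proof -
  interpret semi_cayley_graph G r m \<phi> R L S
    using assms
    by (intro semi_cayley_graph.intro finite_comm_group_decomposition.intro
        finite_comm_group_decomposition_axioms.intro semi_cayley_graph_axioms.intro)
  have a: "a \<in> carrier G"
    using assms by simp
  have a_ne_one_iff: "a \<noteq> \<one>\<^bsub>G\<^esub> \<longleftrightarrow> g \<noteq> h"
    using assms by (metis inv_closed inv_equality inv_inv l_inv)
  \<comment> \<open>Both directions pass through this form of the spectral condition, which makes
    sense before the values of \<open>\<chi> a\<close> are known to be 1 or -1.\<close>
  define eigen where "eigen \<longleftrightarrow> (\<forall>z\<in>carrier G.
      exp (\<i> * of_real t * lam_minus z) = \<alpha> + \<beta> * \<chi> a z \<and>
      (\<chi>s z S \<noteq> 0 \<longrightarrow> exp (\<i> * of_real t * lam_plus z) = \<alpha> + \<beta> * \<chi> a z))"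
  have revival: "?revival \<longleftrightarrow> g \<noteq> h \<and> (cmod \<alpha>)\<^sup>2 + (cmod \<beta>)\<^sup>2 = 1 \<and> eigen"
    using revival_iff_eigenvalues[of g h \<alpha> \<beta> t] assms
    by (simp add: eigen_def character_commute[of _ "inv\<^bsub>G\<^esub> g \<otimes>\<^bsub>G\<^esub> h"])
  have spectrum: "?spectrum \<longleftrightarrow> eigen" if "\<And>z. z \<in> carrier G \<Longrightarrow> \<chi> a z = 1 \<or> \<chi> a z = -1"
  proof
    assume ?spectrum
    show eigen
      unfolding eigen_def
    proof
      fix z assume z: "z \<in> carrier G"
      from that[OF z] show "exp (\<i> * of_real t * lam_minus z) = \<alpha> + \<beta> * \<chi> a z \<and>
          (\<chi>s z S \<noteq> 0 \<longrightarrow> exp (\<i> * of_real t * lam_plus z) = \<alpha> + \<beta> * \<chi> a z)"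
        using \<open>?spectrum\<close> z assms(15,17,18) by auto
    qed
  next
    assume eigen
    then show ?spectrum
      using assms(15,17,18) by (auto simp: eigen_def)
  qed
  have norm_one: "cmod (\<alpha> + \<beta> * \<chi> a z) = 1" if "eigen" "z \<in> carrier G" for z
    using that norm_exp_lambda_minus[of t z] by (simp add: eigen_def)
  have \<chi>_one: "\<chi> a \<one>\<^bsub>G\<^esub> = 1"
    by simp
  have forward: "?order \<and> ?spectrum" if ?revival
  proof -
    have ne: "g \<noteq> h" and unit: "(cmod \<alpha>)\<^sup>2 + (cmod \<beta>)\<^sup>2 = 1" and eigen
      using that revival by auto
    have orth: "Re (cnj \<alpha> * \<beta> * \<chi> a z) = 0" if "z \<in> carrier G" for z
      using norm_add_unit_mult[of "\<chi> a z" \<alpha> \<beta>] norm_one[OF \<open>eigen\<close> that] unit by simp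
    have imaginary: "Re (cnj \<alpha> * \<beta>) = 0"
      using orth[OF one_closed] by (simp only: \<chi>_one mult_1_right)
    moreover have "cnj \<alpha> * \<beta> \<noteq> 0"
      using assms(11,12) by simp
    ultimately have "Im (cnj \<alpha> * \<beta>) \<noteq> 0"
      using complex_eqI[of "cnj \<alpha> * \<beta>" 0] by auto
    \<comment> \<open>As \<open>cnj \<alpha> * \<beta>\<close> is nonzero and purely imaginary,
      \<open>orth\<close> forces the imaginary part of \<open>\<chi> a z\<close> to vanish.\<close>
    then have pm: "\<chi> a z = 1 \<or> \<chi> a z = -1" if "z \<in> carrier G" for z
      using orth[OF that] imaginary
      by (intro unit_circle_real_cases) (simp_all only: times_complex.sel norm_character, simp)
    \<comment> \<open>Every character takes the value 1 at the square of \<open>a\<close>, and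
      characters separate points.\<close>
    have "a \<otimes>\<^bsub>G\<^esub> a = \<one>\<^bsub>G\<^esub>"
    proof (rule ccontr)
      assume "a \<otimes>\<^bsub>G\<^esub> a \<noteq> \<one>\<^bsub>G\<^esub>"
      then obtain z where z: "z \<in> carrier G" "\<chi> z (a \<otimes>\<^bsub>G\<^esub> a) \<noteq> 1"
        using exists_nontrivial_character a by blast
      then show False
        using pm[OF z(1)] a by (auto simp: character_mult character_commute[of z a])
    qed
    then have "ord a dvd 2"
      using a pow_eq_id[of a 2] by (simp add: numeral_2_eq_2)
    moreover have "ord a \<noteq> 1"
      using a a_ne_one_iff ne ord_eq_1 by blast
    ultimately have "ord a = 2"
      by (cases "ord a = 0") (auto dest: dvd_imp_le)
    then have ?order
      using ord_dvd_group_order[OF a] assms(3) by simp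
    then show ?thesis
      using spectrum pm \<open>eigen\<close> by blast
  qed
  have backward: ?revival if order: ?order and sp: ?spectrum
  proof -
    have ord: "ord a = 2"
      using order by simp
    then have sq: "a \<otimes>\<^bsub>G\<^esub> a = \<one>\<^bsub>G\<^esub>"
      using a pow_ord_eq_1[of a] by (simp add: numeral_2_eq_2)
    have ne: "a \<noteq> \<one>\<^bsub>G\<^esub>"
      using ord by auto
    have pm: "\<chi> a z = 1 \<or> \<chi> a z = -1" for z
    proof -
      have "\<chi> z a * \<chi> z a = 1"
        using character_mult[OF a a, of z] sq by simp
      then show ?thesis
        by (simp add: character_commute[of a] square_eq_1_iff)
    qed
    have eigen
      using spectrum pm sp by blast
    obtain z where z: "z \<in> carrier G" "\<chi> a z = -1"
      using exists_nontrivial_character[OF a ne] pm by (metis character_commute)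
    \<comment> \<open>The normalisation of \<alpha> and \<beta> must be recovered here: the values 1
      and -1 of \<open>\<chi> a\<close> give cross terms of opposite sign, which cancel as in the
      parallelogram law.\<close>
    have "(cmod (\<alpha> + \<beta> * 1))\<^sup>2 = 1" "(cmod (\<alpha> + \<beta> * -1))\<^sup>2 = 1"
      using norm_one[OF \<open>eigen\<close> one_closed] norm_one[OF \<open>eigen\<close> z(1)] z(2) by simp_all
    then have "(cmod \<alpha>)\<^sup>2 + (cmod \<beta>)\<^sup>2 = 1"
      by (subst (asm) (1 2) norm_add_unit_mult) simp_all
    then show ?revival
      using revival ne a_ne_one_iff \<open>eigen\<close> by blast
  qed
  show ?thesis
    using forward backward by blast
qed

end
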